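(* There exists a simple $4$-$(15,5,2)$ design.
   Context: A $t$-$(v,k,\lambda)$ design consists of a $v$-element set $P$ of points together with a collection $B$ of $k$-element subsets of $P$ (called blocks) such that every $t$-element subset of $P$ is contained in exactly $\lambda$ blocks. The design is simple if $B$ is a set, i.e. contains no repeated blocks. *)

theory Defs
  imports Main "HOL-Library.Multiset"
begin

text \<open>
  The blocks form a multiset, so that repeated blocks are possible in a design
  and are counted with multiplicity; simplicity is a separate condition.
\<close>

definition t_design ::
    "nat \<Rightarrow> nat \<Rightarrow> nat \<Rightarrow> nat \<Rightarrow> 'a set \<Rightarrow> 'a set multiset \<Rightarrow> bool" where
  "t_design t v k l P B \<longleftrightarrow>
     finite P \<and> card P = v \<and>
     (\<forall>b \<in># B. b \<subseteq> P \<and> card b = k) \<and>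
     (\<forall>T. T \<subseteq> P \<and> card T = t \<longrightarrow> size {#b \<in># B. T \<subseteq> b#} = l)"

definition simple_blocks :: "'a set multiset \<Rightarrow> bool" where
  "simple_blocks B \<longleftrightarrow> (\<forall>b. count B b \<le> 1)"

end

theory Submission
  imports Defs
begin

text \<open>
  The design is invariant under the cyclic group of order 13 that permutes the points
  \<open>0, \<dots>, 12\<close> and fixes \<open>13\<close> and \<open>14\<close>. Prescribing this group turns the search for a design
  into a small exact cover problem on orbits (105 orbits of 4-subsets, 231 orbits of
  5-subsets); a solution consists of 42 regular orbits.
\<close>

text \<open>Blocks are lists so that counting is executable; counting list entries keeps
  multiplicities, as the multiset in \<open>t_design\<close> does.\<close>

definition cover_count :: "'a list list \<Rightarrow> 'a set \<Rightarrow> nat" where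
  "cover_count bs T = length (filter (\<lambda>b. T \<subseteq> set b) bs)"

lemma cover_count_concat:
  "cover_count (concat (map f [0..<n])) T = (\<Sum>i<n. cover_count (f i) T)"
  by (induction n) (simp_all add: cover_count_def)

lemma cover_count_map_inj:
  assumes "inj f"
  shows "cover_count (map (map f) bs) (f ` T) = cover_count bs T"
  using assms by (induction bs) (simp_all add: cover_count_def inj_image_subset_iff)

lemma t_design_of_lists:
  fixes P :: "'a set" and bs :: "'a list list"
  assumes "finite P" "card P = v"
    and "\<And>b. b \<in> set bs \<Longrightarrow> set b \<subseteq> P \<and> card (set b) = k"
    and "\<And>T. T \<subseteq> P \<Longrightarrow> card T = t \<Longrightarrow> cover_count bs T = l"
  shows "t_design t v k l P (mset (map set bs))"
proof -
  have "size {#b \<in># mset (map set bs). T \<subseteq> b#} = cover_count bs T" for T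
    unfolding cover_count_def by (induction bs) auto
  then show ?thesis using assms by (auto simp: t_design_def)
qed

text \<open>Each copy of a block contains that block, so its multiplicity is bounded by its cover
  count. Simplicity thereby becomes a covering condition of the same kind as the design
  property.\<close>

lemma simple_blocks_of_lists:
  fixes bs :: "'a list list"
  assumes "\<And>b. b \<in> set bs \<Longrightarrow> cover_count bs (set b) \<le> 1"
  shows "simple_blocks (mset (map set bs))"
  unfolding simple_blocks_def
proof
  fix b
  show "count (mset (map set bs)) b \<le> 1"
  proof (cases "b \<in># mset (map set bs)")
    case True
    have "count (mset (map set bs)) b \<le> cover_count bs b"
      unfolding cover_count_def by (induction bs) auto
    also have "\<dots> \<le> 1" using assms True by auto
    finally show ?thesis .
  next
    case False
    then show ?thesis by (metis count_inI zero_le)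
  qed
qed

text \<open>
  Descending the point list and filtering the blocks along the way shares the work between
  all \<open>t\<close>-subsets with a common prefix, which keeps evaluation by rewriting feasible.
\<close>

fun check_cover :: "nat \<Rightarrow> (nat \<Rightarrow> bool) \<Rightarrow> 'a list \<Rightarrow> 'a list list \<Rightarrow> bool" where
  "check_cover 0 Q ps bs = Q (length bs)"
| "check_cover (Suc t) Q [] bs = True"
| "check_cover (Suc t) Q (p # ps) bs =
     (check_cover t Q ps (filter (\<lambda>b. List.member b p) bs) \<and> check_cover (Suc t) Q ps bs)"

lemma cover_count_remove:
  assumes "p \<in> T"
  shows "cover_count (filter (\<lambda>b. List.member b p) bs) (T - {p}) = cover_count bs T"
  unfolding cover_count_def using assms by (induction bs) auto

text \<open>The set \<open>T\<close> is reached by the branch that filters at the points of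
  \<open>T\<close> and skips the others. When the points run out early, no \<open>T\<close> of
  positive size is left.\<close>

lemma check_cover_sound:
  assumes "check_cover t Q ps bs" "T \<subseteq> set ps" "card T = t"
  shows "Q (cover_count bs T)"
  using assms
proof (induction t Q ps bs arbitrary: T rule: check_cover.induct)
  case (1 Q ps bs)
  then have "T = {}" using finite_subset[of T "set ps"] by simp
  then show ?case using 1 by (simp add: cover_count_def)
next
  case (2 t Q bs)
  then show ?case by simp
next
  case (3 t Q p ps bs)
  show ?case
  proof (cases "p \<in> T")
    case True
    have "Q (cover_count (filter (\<lambda>b. List.member b p) bs) (T - {p}))"
      using 3 True by (intro "3.IH"(1)) auto
    then show ?thesis by (simp only: cover_count_remove[OF True])
  next
    case False
    then show ?thesis using 3 by (intro "3.IH"(2)) auto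
  qed
qed

text \<open>One representative, chosen to contain 0, for each of the 42 orbits. The 42 * 13 = 546
  translates match the block count 2 * 1365 / 5 forced by the parameters.\<close>

definition base_blocks :: "nat list list" where
  "base_blocks =
    [[0,1,2,3,4], [0,1,2,4,10], [0,1,2,5,6], [0,1,2,5,13], [0,1,2,6,7],
     [0,1,2,7,10], [0,1,2,8,13], [0,1,2,8,14], [0,1,2,9,11], [0,1,2,9,14],
     [0,1,3,4,9], [0,1,3,5,8], [0,1,3,5,14], [0,1,3,6,8], [0,1,3,6,11],
     [0,1,3,7,10], [0,1,3,7,14], [0,1,3,10,13], [0,1,3,11,13], [0,1,4,5,8],
     [0,1,4,6,7], [0,1,4,6,14], [0,1,4,7,13], [0,1,4,8,11], [0,1,4,11,14],
     [0,1,5,7,9], [0,1,5,7,11], [0,1,5,9,11], [0,1,5,10,13], [0,1,5,10,14],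
     [0,1,6,8,13], [0,1,6,9,13], [0,1,6,10,14], [0,1,9,13,14], [0,1,11,13,14],
     [0,2,4,6,13], [0,2,4,7,14], [0,2,4,8,10], [0,2,5,8,14], [0,2,6,10,13],
     [0,2,7,13,14], [0,3,7,13,14]]"

definition translate :: "nat \<Rightarrow> nat \<Rightarrow> nat" where
  "translate i x = (if x < 13 then (x + i) mod 13 else x)"

definition design_blocks :: "nat list list" where
  "design_blocks = concat (map (\<lambda>i. map (map (translate i)) base_blocks) [0..<13])"

lemma translate_add: "translate i (translate j x) = translate (i + j) x"
  by (simp add: translate_def mod_simps ac_simps)

lemma translate_13: "translate 13 = translate 0"
  by (rule ext) (simp add: translate_def)

lemma inj_translate: "inj (translate i)"
proof (rule injI)
  fix x y assume "translate i x = translate i y"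
  \<comment> \<open>Since 12 is -1 modulo 13, translation by \<open>12 * i\<close> undoes
    translation by \<open>i\<close>.\<close>
  then have "translate (12 * i) (translate i x) = translate (12 * i) (translate i y)"
    by simp
  then show "x = y"
    unfolding translate_add by (auto simp: translate_def split: if_splits)
qed

lemma translate_less: "x < 15 \<Longrightarrow> translate i x < 15"
  using mod_less_divisor[of 13 "x + i"] by (auto simp: translate_def simp del: mod_less_divisor)

text \<open>Translation by 1 permutes the 13 translates of the base blocks cyclically, so the total
  count is invariant.\<close>

lemma cover_count_translate_1:
  "cover_count design_blocks (translate 1 ` T) = cover_count design_blocks T"
proof -
  define g where "g i = cover_count (map (map (translate i)) base_blocks)" for i
  have shift: "g (Suc i) (translate 1 ` T) = g i T" for i
    using cover_count_map_inj[OF inj_translate[of 1], of "map (map (translate i)) base_blocks" T]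
    by (simp add: g_def o_def translate_add)
  have count: "cover_count design_blocks S = (\<Sum>i<13. g i S)" for S
    by (simp add: design_blocks_def cover_count_concat g_def)
  \<comment> \<open>The sum over \<open>i < Suc 13\<close> is split off at its first and at its last
    term; these agree by \<open>translate_13\<close> and cancel.\<close>
  have rotate: "(\<Sum>i<13. g i S) = (\<Sum>i<13. g (Suc i) S)" for S
    using sum.lessThan_Suc_shift[of "\<lambda>i. g i S" 13] sum.lessThan_Suc[of "\<lambda>i. g i S" 13]
    by (simp add: g_def translate_13 del: sum.lessThan_Suc)
  show ?thesis by (simp only: count shift rotate[of "translate 1 ` T"])
qed

lemma cover_count_translate:
  "cover_count design_blocks (translate n ` T) = cover_count design_blocks T"
proof (induction n)
  case 0
  have "translate 0 ` T = T" by (auto simp: translate_def)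
  then show ?case by simp
next
  case (Suc n)
  have "translate (Suc n) ` T = translate 1 ` translate n ` T"
    by (simp add: image_image translate_add)
  then show ?case using Suc by (simp only: cover_count_translate_1)
qed

text \<open>
  A set of at least three points contains a point below 13, which some translation moves to 0.
\<close>

lemma cover_count_design_blocks:
  assumes check: "check_cover t Q [1..<15] (filter (\<lambda>b. List.member b 0) design_blocks)"
    and T: "T \<subseteq> {0..<15}" "card T = Suc t" and "2 \<le> t"
  shows "Q (cover_count design_blocks T)"
proof -
  have "\<not> T \<subseteq> {13, 14}" using card_mono[of "{13, 14}" T] T \<open>2 \<le> t\<close> by auto
  then obtain x where x: "x \<in> T" "x < 13" using T by fastforce
  \<comment> \<open>This translation moves \<open>x\<close> to 13 mod 13 = 0.\<close>
  define U where "U = translate (13 - x) ` T"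
  have "0 \<in> U" unfolding U_def using x by (intro image_eqI[of _ _ x]) (auto simp: translate_def)
  moreover have "U \<subseteq> {0..<15}" using T translate_less by (force simp: U_def)
  moreover have "card U = Suc t"
    using T by (simp add: U_def card_image inj_on_subset[OF inj_translate])
  ultimately have "U - {0} \<subseteq> set [1..<15]" "card (U - {0}) = t" by force+
  from check_cover_sound[OF check this] show ?thesis
    using cover_count_remove[OF \<open>0 \<in> U\<close>, of design_blocks] by (simp add: U_def cover_count_translate)
qed

lemma base_blocks_wf:
  "\<forall>b\<in>set base_blocks. distinct b \<and> length b = 5 \<and> (\<forall>x\<in>set b. x < 15)"
  by (simp add: base_blocks_def)

lemma design_blocks_wf:
  assumes "b \<in> set design_blocks"
  shows "set b \<subseteq> {0..<15} \<and> card (set b) = 5"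
proof -
  obtain i c where b: "b = map (translate i) c" and "c \<in> set base_blocks"
    using assms by (auto simp: design_blocks_def)
  then have c: "distinct c" "length c = 5" "\<forall>x\<in>set c. x < 15" using base_blocks_wf by auto
  then have "distinct b" using b by (simp add: distinct_map inj_on_subset[OF inj_translate])
  then have "card (set b) = 5" using b c distinct_card by fastforce
  then show ?thesis using b c translate_less by auto
qed

text \<open>The depth is 3 rather than 4 because the filter has already used the point 0.\<close>

lemma check_cover_4:
  "check_cover 3 (\<lambda>n. n = 2) [1..<15] (filter (\<lambda>b. List.member b 0) design_blocks)"
  by code_simp

text \<open>Blocks have 5 points, so a bound of 1 on 5-subsets through 0 is what simplicity
  requires, up to translation.\<close>

lemma check_cover_5:
  "check_cover 4 (\<lambda>n. n \<le> 1) [1..<15] (filter (\<lambda>b. List.member b 0) design_blocks)"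
  by code_simp

theorem theorem6:
  "\<exists>(P :: nat set) (B :: nat set multiset). t_design 4 15 5 2 P B \<and> simple_blocks B"
proof (intro exI conjI)
  show "t_design 4 15 5 2 {0..<15} (mset (map set design_blocks))"
    using cover_count_design_blocks[OF check_cover_4] design_blocks_wf
    by (intro t_design_of_lists) auto
  show "simple_blocks (mset (map set design_blocks))"
    using cover_count_design_blocks[OF check_cover_5] design_blocks_wf
    by (intro simple_blocks_of_lists) auto
qed

end
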